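(* Let $\Theta\subseteq\mathbb{R}$ and let $\{p(\cdot|\theta),\ \theta\in\Theta\}$ be a parametric family of probability density functions of $\boldsymbol{X}=(X_1,\ldots,X_n)$, $n\ge1$. Let $\rho:\mathbb{R}\to[0,\infty)$ be a convex, symmetric ($\rho(-\epsilon)=\rho(\epsilon)$) loss function, non-increasing on $(-\infty,0]$, non-decreasing on $[0,\infty)$, with $\rho(0)=0$. For a given $\theta\in\Theta$ and a constant $s$, let $\{\xi_n\}_{n\ge1}$ denote a sequence tending to zero with the property that $$\lim_{n\to\infty}\max_{q}P_{\mathrm{e}}(q,\theta,\theta+2s\xi_n)$$ exists and is given by a strictly positive constant, which is denoted by $P_{\mathrm{e}}^\infty(\theta,s)$. Also, let $$\omega(s)=\lim_{u\to0}\frac{\rho(s\cdot u)}{\rho(u)}.$$ Then the local asymptotic minimax performance at $\theta$ with respect to $\zeta_n=1/\rho(\xi_n)$ is lower bounded by $$r(\theta)\ \ge\ \sup_{s\in\mathbb{R}}\left\{2\,\omega(s)\cdot P_{\mathrm{e}}^\infty(\theta,s)\right\}.$$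
   Context: Each $X_i$ takes values in an alphabet $\mathcal{X}$ (a finite or countable set, an interval, or the real line); in the discrete case densities are probability mass functions and integrals over the observation space are sums. $\mathbf{E}_\theta$ denotes expectation with respect to $p(\cdot|\theta)$. An estimator is a function $g_n:\mathcal{X}^n\to\Theta$. For $q\in[0,1]$ and $\theta_0,\theta_1\in\Theta$ (with dependence on $n$ implicit), $$P_{\mathrm{e}}(q,\theta_0,\theta_1)=\int_{\mathbb{R}^n}\min\{q\cdot p(\boldsymbol{x}|\theta_0),(1-q)\cdot p(\boldsymbol{x}|\theta_1)\}\,d\boldsymbol{x},$$ which is the error probability of the optimal maximum a posteriori rule for testing $\boldsymbol{X}\sim p(\cdot|\theta_0)$ against $\boldsymbol{X}\sim p(\cdot|\theta_1)$ with priors $q$ and $1-q$; the maximum over $q$ is over $[0,1]$. The local asymptotic minimax performance at $\theta$ with respect to a positive sequence $\{\zeta_n\}$ tending to infinity is $$r(\theta)=\lim_{\delta\downarrow0}\liminf_{n\to\infty}\inf_{g_n}\ \sup_{\{\theta':\,|\theta'-\theta|\le\delta\}}\zeta_n\cdot\mathbf{E}_{\theta'}\{\rho(g_n[\boldsymbol{X}]-\theta')\},$$ where the infimum is over all estimators and $\theta'$ ranges over parameter values in $\Theta$; this terminology is used when the sequence is such that $r(\theta)$ is a strictly positive finite constant. *)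

theory Defs
  imports "HOL-Probability.Probability"
begin

text \<open>
  The alphabet and its reference measure are bundled in a measure \<open>M\<close>: \<open>count_space A\<close> for a
  finite or countable alphabet \<open>A\<close>, \<open>restrict_space lborel I\<close> for an interval \<open>I\<close>, and \<open>lborel\<close>
  for the real line.
\<close>

definition observation_space :: "'x measure \<Rightarrow> nat \<Rightarrow> (nat \<Rightarrow> 'x) measure" where
  "observation_space M n = PiM {1..n} (\<lambda>_. M)"

text \<open>
  \<open>p n \<theta>\<close> is the joint density of the first \<open>n\<close> observations; neither a product form nor any
  consistency between different \<open>n\<close> is required.
\<close>

definition density_family ::
  "'x measure \<Rightarrow> real set \<Rightarrow> (nat \<Rightarrow> real \<Rightarrow> (nat \<Rightarrow> 'x) \<Rightarrow> real) \<Rightarrow> bool" where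
  "density_family M \<Theta> p \<longleftrightarrow>
    (\<forall>n\<ge>1. \<forall>\<theta>\<in>\<Theta>.
      p n \<theta> \<in> borel_measurable (observation_space M n) \<and>
      (\<forall>x\<in>space (observation_space M n). 0 \<le> p n \<theta> x) \<and>
      (\<integral>\<^sup>+x. ennreal (p n \<theta> x) \<partial>observation_space M n) = 1)"

definition estimators :: "'x measure \<Rightarrow> real set \<Rightarrow> nat \<Rightarrow> ((nat \<Rightarrow> 'x) \<Rightarrow> real) set" where
  "estimators M \<Theta> n =
    {g \<in> borel_measurable (observation_space M n). \<forall>x\<in>space (observation_space M n). g x \<in> \<Theta>}"

text \<open>Expected losses may be infinite, hence the values in \<open>[0, \<infinity>]\<close>.\<close>

definition risk ::
  "'x measure \<Rightarrow> (nat \<Rightarrow> real \<Rightarrow> (nat \<Rightarrow> 'x) \<Rightarrow> real) \<Rightarrow> (real \<Rightarrow> real) \<Rightarrow> nat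
    \<Rightarrow> ((nat \<Rightarrow> 'x) \<Rightarrow> real) \<Rightarrow> real \<Rightarrow> ennreal" where
  "risk M p \<rho> n g \<theta> =
    (\<integral>\<^sup>+x. ennreal (\<rho> (g x - \<theta>))
      \<partial>density (observation_space M n) (\<lambda>x. ennreal (p n \<theta> x)))"

definition local_asymptotic_minimax ::
  "'x measure \<Rightarrow> real set \<Rightarrow> (nat \<Rightarrow> real \<Rightarrow> (nat \<Rightarrow> 'x) \<Rightarrow> real) \<Rightarrow> (real \<Rightarrow> real)
    \<Rightarrow> (nat \<Rightarrow> real) \<Rightarrow> real \<Rightarrow> ennreal" where
  "local_asymptotic_minimax M \<Theta> p \<rho> \<zeta> \<theta> =
    Lim (at_right 0) (\<lambda>\<delta>::real.
      liminf (\<lambda>n. INF g\<in>estimators M \<Theta> n.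
        SUP \<theta>'\<in>{\<theta>'\<in>\<Theta>. \<bar>\<theta>' - \<theta>\<bar> \<le> \<delta>}. ennreal (\<zeta> n) * risk M p \<rho> n g \<theta>'))"

definition error_prob ::
  "'x measure \<Rightarrow> (nat \<Rightarrow> real \<Rightarrow> (nat \<Rightarrow> 'x) \<Rightarrow> real) \<Rightarrow> nat \<Rightarrow> real \<Rightarrow> real \<Rightarrow> real \<Rightarrow> real" where
  "error_prob M p n q \<theta>\<^sub>0 \<theta>\<^sub>1 =
    (LINT x|observation_space M n. min (q * p n \<theta>\<^sub>0 x) ((1 - q) * p n \<theta>\<^sub>1 x))"

text \<open>
  For densities the error probability is a continuous function of \<open>q\<close> on \<open>{0..1}\<close>, so
  the supremum below is attained.
\<close>

definition max_error_prob ::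
  "'x measure \<Rightarrow> (nat \<Rightarrow> real \<Rightarrow> (nat \<Rightarrow> 'x) \<Rightarrow> real) \<Rightarrow> nat \<Rightarrow> real \<Rightarrow> real \<Rightarrow> real" where
  "max_error_prob M p n \<theta>\<^sub>0 \<theta>\<^sub>1 = (SUP q\<in>{0..1}. error_prob M p n q \<theta>\<^sub>0 \<theta>\<^sub>1)"

definition limit_error_prob ::
  "'x measure \<Rightarrow> (nat \<Rightarrow> real \<Rightarrow> (nat \<Rightarrow> 'x) \<Rightarrow> real) \<Rightarrow> (nat \<Rightarrow> real) \<Rightarrow> real \<Rightarrow> real \<Rightarrow> real" where
  "limit_error_prob M p \<xi> \<theta> s = lim (\<lambda>n. max_error_prob M p n \<theta> (\<theta> + 2 * s * \<xi> n))"

text \<open>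
  The limit is taken in \<open>[0, \<infinity>]\<close>: for a loss behaving like \<open>exp (- 1 / u\<^sup>2)\<close> near \<open>0\<close> the ratio
  tends to \<open>\<infinity>\<close> whenever \<open>\<bar>s\<bar> > 1\<close>.
\<close>

definition loss_ratio :: "(real \<Rightarrow> real) \<Rightarrow> real \<Rightarrow> real \<Rightarrow> ennreal" where
  "loss_ratio \<rho> s u = ennreal (\<rho> (s * u) / \<rho> u)"

definition loss_ratio_limit :: "(real \<Rightarrow> real) \<Rightarrow> real \<Rightarrow> ennreal" where
  "loss_ratio_limit \<rho> s = Lim (at 0) (loss_ratio \<rho> s)"

end

theory Submission
  imports Defs
begin

text \<open>
  Le Cam's two-point method: the supremum of the risk over a neighbourhood of \<open>\<theta>\<close> is at least any
  convex combination of the risks at \<open>\<theta>\<close> and \<open>\<theta> + 2 s \<xi>\<^sub>n\<close>. Bounding both weighted densities below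
  by their minimum and using midpoint convexity,
  \<open>\<rho> (g - \<theta>\<^sub>0) + \<rho> (g - \<theta>\<^sub>1) \<ge> 2 \<rho> ((\<theta>\<^sub>1 - \<theta>\<^sub>0) / 2)\<close>, removes the estimator from the
  integrand and leaves \<open>2 \<rho> (s \<xi>\<^sub>n)\<close> times the error probability.
\<close>

text \<open>By symmetry the last term equals \<open>\<rho> (b - g)\<close>. The points
  \<open>g - a\<close> and \<open>b - g\<close> have midpoint \<open>(b - a) / 2\<close>, in which
  \<open>g\<close> cancels, so midpoint convexity gives a bound free of the estimate.\<close>

lemma convex_symmetric_loss_sum_ge:
  fixes \<rho> :: "real \<Rightarrow> real"
  assumes "convex_on UNIV \<rho>" and "\<And>\<epsilon>. \<rho> (- \<epsilon>) = \<rho> \<epsilon>"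
  shows "2 * \<rho> ((b - a) / 2) \<le> \<rho> (g - a) + \<rho> (g - b)"
proof -
  have mid: "(1 - 1/2) *\<^sub>R (g - a) + (1/2) *\<^sub>R (- (g - b)) = (b - a) / 2"
    by (simp add: field_simps)
  have "\<rho> ((1 - 1/2) *\<^sub>R (g - a) + (1/2) *\<^sub>R (- (g - b)))
      \<le> (1 - 1/2) * \<rho> (g - a) + 1/2 * \<rho> (- (g - b))"
    by (rule convex_onD[OF assms(1)]) auto
  then show ?thesis
    unfolding mid assms(2) by simp
qed

text \<open>A value below \<open>y\<close> at a single \<open>b\<close> persists on all of
  \<open>(a, b)\<close> by monotonicity, while the infimum bounds every value from below. This makes
  the limit over shrinking neighbourhoods a genuine one.\<close>

lemma tendsto_at_right_mono_on:
  fixes F :: "real \<Rightarrow> 'a::{complete_linorder, linorder_topology}"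
  assumes "mono_on {a<..} F"
  shows "(F \<longlongrightarrow> (INF x\<in>{a<..}. F x)) (at_right a)"
proof (rule order_tendstoI)
  fix y assume "y < (INF x\<in>{a<..}. F x)"
  then have "y < F x" if "a < x" for x
    using that by (meson INF_lower greaterThan_iff less_le_trans)
  then show "\<forall>\<^sub>F x in at_right a. y < F x"
    by (auto simp: eventually_at_filter)
next
  fix y assume "(INF x\<in>{a<..}. F x) < y"
  then obtain b where b: "a < b" "F b < y"
    by (auto simp: INF_less_iff)
  have "F x < y" if "a < x" "x < b" for x
    using mono_onD[OF assms, of x b] that b by auto
  then show "\<forall>\<^sub>F x in at_right a. F x < y"
    using b(1) by (auto simp: eventually_at_right_field)
qed

text \<open>The supremum is one of reals, so the bound must be brought back to the reals: outside
  the trivial case, \<open>V / c\<close> is finite and bounds every \<open>f x\<close>. This carries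
  bounds for each prior weight \<open>q\<close> over to \<open>max_error_prob\<close>.\<close>

lemma ennreal_cSUP_le:
  fixes f :: "'a \<Rightarrow> real"
  assumes "A \<noteq> {}" and le: "\<And>x. x \<in> A \<Longrightarrow> c * ennreal (f x) \<le> V" and "c \<noteq> \<top>"
  shows "c * ennreal (SUP x\<in>A. f x) \<le> V"
proof (cases "c = 0 \<or> V = \<top>")
  case True
  then show ?thesis by auto
next
  case False
  have "ennreal (f x) \<le> V / c" if "x \<in> A" for x
    using le[OF that] False \<open>c \<noteq> \<top>\<close>
    by (metis divide_right_mono_ennreal ennreal_mult_divide_eq mult.commute)
  moreover have "V / c \<noteq> \<top>"
    using False by (auto simp: ennreal_divide_eq_top_iff)
  ultimately have "f x \<le> enn2real (V / c)" if "x \<in> A" for x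
    using that by (metis enn2real_nonneg ennreal_enn2real ennreal_le_iff top.not_eq_extremum)
  then have "(SUP x\<in>A. f x) \<le> enn2real (V / c)"
    by (intro cSUP_least[OF assms(1)])
  then have "ennreal (SUP x\<in>A. f x) \<le> V / c"
    using \<open>V / c \<noteq> \<top>\<close> by (metis ennreal_enn2real ennreal_leI top.not_eq_extremum)
  then have "c * ennreal (SUP x\<in>A. f x) \<le> c * (V / c)"
    by (rule mult_left_mono) simp
  also have "\<dots> = V"
    using False \<open>c \<noteq> \<top>\<close>
    by (metis ennreal_mult_divide_eq ennreal_times_divide mult.commute)
  finally show ?thesis .
qed

text \<open>A non-integrable \<open>f\<close> is covered because its Bochner integral defaults to 0;
  otherwise both sides agree.\<close>

lemma ennreal_lebesgue_integral_le:
  assumes "f \<in> borel_measurable N" and "\<And>x. x \<in> space N \<Longrightarrow> 0 \<le> f x"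
  shows "ennreal (LINT x|N. f x) \<le> (\<integral>\<^sup>+x. ennreal (f x) \<partial>N)"
proof -
  have "(LINT x|N. f x) = enn2real (\<integral>\<^sup>+x. ennreal (f x) \<partial>N)"
    using assms by (intro integral_eq_nn_integral) auto
  then show ?thesis
    by (cases "(\<integral>\<^sup>+x. ennreal (f x) \<partial>N) = \<top>") (auto simp: less_top)
qed

text \<open>The right side is the Bayes risk of \<open>g\<close> under the prior with weights
  \<open>q\<close> and \<open>1 - q\<close>. The left side is free of \<open>g\<close>, which later
  permits the infimum over estimators.\<close>

lemma two_point_bound:
  fixes \<rho> :: "real \<Rightarrow> real"
  assumes dens: "density_family M \<Theta> p" and n: "n \<ge> 1"
    and \<rho>: "\<And>\<epsilon>. 0 \<le> \<rho> \<epsilon>" "convex_on UNIV \<rho>" "\<And>\<epsilon>. \<rho> (- \<epsilon>) = \<rho> \<epsilon>"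
    and g: "g \<in> estimators M \<Theta> n"
    and \<Theta>: "\<theta>\<^sub>0 \<in> \<Theta>" "\<theta>\<^sub>1 \<in> \<Theta>"
    and q: "q \<in> {0..1}"
  shows "ennreal (2 * \<rho> ((\<theta>\<^sub>1 - \<theta>\<^sub>0) / 2)) * ennreal (error_prob M p n q \<theta>\<^sub>0 \<theta>\<^sub>1)
    \<le> ennreal q * risk M p \<rho> n g \<theta>\<^sub>0 + ennreal (1 - q) * risk M p \<rho> n g \<theta>\<^sub>1"
proof -
  define N where "N = observation_space M n"
  have [measurable]: "g \<in> borel_measurable N"
    using g by (simp add: estimators_def N_def)
  have [measurable]: "\<rho> \<in> borel_measurable borel"
    using convex_on_continuous[OF open_UNIV \<rho>(2)] by (rule borel_measurable_continuous_onI)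
  have [measurable]: "p n \<theta>\<^sub>0 \<in> borel_measurable N" "p n \<theta>\<^sub>1 \<in> borel_measurable N"
    and nonneg: "\<And>x. x \<in> space N \<Longrightarrow> 0 \<le> p n \<theta>\<^sub>0 x" "\<And>x. x \<in> space N \<Longrightarrow> 0 \<le> p n \<theta>\<^sub>1 x"
    using dens n \<Theta> unfolding density_family_def N_def by blast+
  have risk_eq: "risk M p \<rho> n g \<theta>' = (\<integral>\<^sup>+x. ennreal (p n \<theta>' x) * ennreal (\<rho> (g x - \<theta>')) \<partial>N)"
    if [measurable]: "p n \<theta>' \<in> borel_measurable N" for \<theta>'
    unfolding risk_def N_def[symmetric] by (subst nn_integral_density) simp_all
  define m where "m x = min (q * p n \<theta>\<^sub>0 x) ((1 - q) * p n \<theta>\<^sub>1 x)" for x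
  have [measurable]: "m \<in> borel_measurable N"
    unfolding m_def by measurable
  have m_nonneg: "0 \<le> m x" if "x \<in> space N" for x
    using nonneg that q by (auto simp: m_def)
  define c where "c = 2 * \<rho> ((\<theta>\<^sub>1 - \<theta>\<^sub>0) / 2)"
  have c: "0 \<le> c"
    by (simp add: c_def \<rho>(1))
  \<comment> \<open>The common factor \<open>m x\<close> lets the two losses be added before
    convexity is used; afterwards it is replaced in each summand by the weighted density that
    dominates it.\<close>
  have pointwise: "c * m x \<le> q * p n \<theta>\<^sub>0 x * \<rho> (g x - \<theta>\<^sub>0) + (1 - q) * p n \<theta>\<^sub>1 x * \<rho> (g x - \<theta>\<^sub>1)"
    if x: "x \<in> space N" for x
  proof -
    have "c * m x \<le> (\<rho> (g x - \<theta>\<^sub>0) + \<rho> (g x - \<theta>\<^sub>1)) * m x"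
      unfolding c_def
      by (intro mult_right_mono convex_symmetric_loss_sum_ge \<rho> m_nonneg x)
    also have "\<dots> = m x * \<rho> (g x - \<theta>\<^sub>0) + m x * \<rho> (g x - \<theta>\<^sub>1)"
      by (simp add: algebra_simps)
    also have "\<dots> \<le> q * p n \<theta>\<^sub>0 x * \<rho> (g x - \<theta>\<^sub>0) + (1 - q) * p n \<theta>\<^sub>1 x * \<rho> (g x - \<theta>\<^sub>1)"
      by (intro add_mono mult_right_mono \<rho>) (auto simp: m_def)
    finally show ?thesis .
  qed
  have "ennreal c * ennreal (error_prob M p n q \<theta>\<^sub>0 \<theta>\<^sub>1) \<le> ennreal c * (\<integral>\<^sup>+x. ennreal (m x) \<partial>N)"
    unfolding error_prob_def m_def[symmetric] N_def[symmetric]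
    by (intro mult_left_mono ennreal_lebesgue_integral_le m_nonneg) auto
  also have "\<dots> = (\<integral>\<^sup>+x. ennreal (c * m x) \<partial>N)"
    using c m_nonneg
    by (subst nn_integral_cmult[symmetric]) (auto simp: ennreal_mult intro!: nn_integral_cong)
  also have "\<dots> \<le> (\<integral>\<^sup>+x. ennreal q * (ennreal (p n \<theta>\<^sub>0 x) * ennreal (\<rho> (g x - \<theta>\<^sub>0)))
      + ennreal (1 - q) * (ennreal (p n \<theta>\<^sub>1 x) * ennreal (\<rho> (g x - \<theta>\<^sub>1))) \<partial>N)"
  proof (intro nn_integral_mono)
    fix x assume x: "x \<in> space N"
    have "ennreal (c * m x)
        \<le> ennreal (q * p n \<theta>\<^sub>0 x * \<rho> (g x - \<theta>\<^sub>0) + (1 - q) * p n \<theta>\<^sub>1 x * \<rho> (g x - \<theta>\<^sub>1))"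
      by (intro ennreal_leI pointwise x)
    then show "ennreal (c * m x)
        \<le> ennreal q * (ennreal (p n \<theta>\<^sub>0 x) * ennreal (\<rho> (g x - \<theta>\<^sub>0)))
          + ennreal (1 - q) * (ennreal (p n \<theta>\<^sub>1 x) * ennreal (\<rho> (g x - \<theta>\<^sub>1)))"
      using q nonneg[OF x] \<rho>(1) by (simp add: ennreal_mult' ennreal_plus mult.assoc)
  qed
  also have "\<dots> = ennreal q * risk M p \<rho> n g \<theta>\<^sub>0 + ennreal (1 - q) * risk M p \<rho> n g \<theta>\<^sub>1"
    by (simp add: risk_eq nn_integral_add nn_integral_cmult)
  finally show ?thesis
    unfolding c_def .
qed

text \<open>A Bayes risk is at most the worst risk \<open>R\<close> over \<open>T\<close>, as the
  weights sum to one. This holds for every \<open>q\<close>, so the supremum over priors is taken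
  with the estimator fixed, and the infimum over estimators comes last.\<close>

lemma local_minimax_risk_ge:
  fixes \<rho> :: "real \<Rightarrow> real"
  assumes dens: "density_family M \<Theta> p" and n: "n \<ge> 1"
    and \<rho>: "\<And>\<epsilon>. 0 \<le> \<rho> \<epsilon>" "convex_on UNIV \<rho>" "\<And>\<epsilon>. \<rho> (- \<epsilon>) = \<rho> \<epsilon>"
    and \<Theta>: "\<theta>\<^sub>0 \<in> T" "\<theta>\<^sub>1 \<in> T" "T \<subseteq> \<Theta>"
  shows "z * (ennreal (2 * \<rho> ((\<theta>\<^sub>1 - \<theta>\<^sub>0) / 2)) * ennreal (max_error_prob M p n \<theta>\<^sub>0 \<theta>\<^sub>1))
    \<le> (INF g\<in>estimators M \<Theta> n. SUP \<theta>'\<in>T. z * risk M p \<rho> n g \<theta>')"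
proof (rule INF_greatest)
  fix g assume g: "g \<in> estimators M \<Theta> n"
  define R where "R = (SUP \<theta>'\<in>T. risk M p \<rho> n g \<theta>')"
  have "ennreal (2 * \<rho> ((\<theta>\<^sub>1 - \<theta>\<^sub>0) / 2)) * ennreal (max_error_prob M p n \<theta>\<^sub>0 \<theta>\<^sub>1) \<le> R"
    unfolding max_error_prob_def
  proof (rule ennreal_cSUP_le)
    fix q :: real assume q: "q \<in> {0..1}"
    have "ennreal (2 * \<rho> ((\<theta>\<^sub>1 - \<theta>\<^sub>0) / 2)) * ennreal (error_prob M p n q \<theta>\<^sub>0 \<theta>\<^sub>1)
        \<le> ennreal q * risk M p \<rho> n g \<theta>\<^sub>0 + ennreal (1 - q) * risk M p \<rho> n g \<theta>\<^sub>1"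
      using \<Theta> by (intro two_point_bound[OF dens n \<rho> g _ _ q]) auto
    also have "\<dots> \<le> ennreal q * R + ennreal (1 - q) * R"
      unfolding R_def using \<Theta> by (intro add_mono mult_left_mono SUP_upper) auto
    also have "\<dots> = R"
      using q by (simp add: distrib_right[symmetric] ennreal_plus[symmetric] del: ennreal_plus)
    finally show "ennreal (2 * \<rho> ((\<theta>\<^sub>1 - \<theta>\<^sub>0) / 2)) * ennreal (error_prob M p n q \<theta>\<^sub>0 \<theta>\<^sub>1) \<le> R" .
  qed auto
  then have "z * (ennreal (2 * \<rho> ((\<theta>\<^sub>1 - \<theta>\<^sub>0) / 2)) * ennreal (max_error_prob M p n \<theta>\<^sub>0 \<theta>\<^sub>1)) \<le> z * R"
    by (rule mult_left_mono) simp
  also have "\<dots> = (SUP \<theta>'\<in>T. z * risk M p \<rho> n g \<theta>')"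
    unfolding R_def by (rule SUP_mult_left_ennreal)
  finally show "z * (ennreal (2 * \<rho> ((\<theta>\<^sub>1 - \<theta>\<^sub>0) / 2)) * ennreal (max_error_prob M p n \<theta>\<^sub>0 \<theta>\<^sub>1))
    \<le> (SUP \<theta>'\<in>T. z * risk M p \<rho> n g \<theta>')" .
qed

text \<open>Enlarging \<delta> enlarges the set of competing parameters, so the expression is
  monotone in \<delta> and its right limit at 0 is an infimum. A bound for each fixed \<delta>
  therefore survives the limit.\<close>

lemma local_asymptotic_minimax_ge:
  assumes "\<And>\<delta>. 0 < \<delta> \<Longrightarrow> L \<le> liminf (\<lambda>n. INF g\<in>estimators M \<Theta> n.
        SUP \<theta>'\<in>{\<theta>'\<in>\<Theta>. \<bar>\<theta>' - \<theta>\<bar> \<le> \<delta>}. ennreal (\<zeta> n) * risk M p \<rho> n g \<theta>')"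
  shows "L \<le> local_asymptotic_minimax M \<Theta> p \<rho> \<zeta> \<theta>"
proof -
  define F where "F \<delta> = liminf (\<lambda>n. INF g\<in>estimators M \<Theta> n.
        SUP \<theta>'\<in>{\<theta>'\<in>\<Theta>. \<bar>\<theta>' - \<theta>\<bar> \<le> \<delta>}. ennreal (\<zeta> n) * risk M p \<rho> n g \<theta>')" for \<delta> :: real
  have "mono_on {0<..} F"
    unfolding F_def
    by (intro mono_onI Liminf_mono always_eventually allI INF_superset_mono SUP_subset_mono) auto
  then have "Lim (at_right 0) F = (INF \<delta>\<in>{0<..}. F \<delta>)"
    by (intro tendsto_Lim tendsto_at_right_mono_on) auto
  moreover have "L \<le> (INF \<delta>\<in>{0<..}. F \<delta>)"
    using assms unfolding F_def by (intro INF_greatest) auto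
  ultimately show ?thesis
    unfolding local_asymptotic_minimax_def F_def by simp
qed

theorem corollary1:
  fixes M :: "'x measure"
    and \<Theta> S :: "real set"
    and p :: "nat \<Rightarrow> real \<Rightarrow> (nat \<Rightarrow> 'x) \<Rightarrow> real"
    and \<rho> :: "real \<Rightarrow> real"
    and \<theta> :: real
    and \<xi> :: "nat \<Rightarrow> real"
  assumes "sigma_finite_measure M"
    and "density_family M \<Theta> p"
    and "\<And>\<epsilon>. 0 \<le> \<rho> \<epsilon>"
    and "convex_on UNIV \<rho>"
    and "\<And>\<epsilon>. \<rho> (- \<epsilon>) = \<rho> \<epsilon>"
    and "antimono_on {..0} \<rho>"
    and "mono_on {0..} \<rho>"
    and "\<rho> 0 = 0"
    and "\<theta> \<in> \<Theta>"
    and "\<xi> \<longlonglongrightarrow> 0"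
    and "\<And>n. n \<ge> 1 \<Longrightarrow> 0 < \<rho> (\<xi> n)"
    and "\<And>s. s \<in> S \<Longrightarrow> \<forall>\<^sub>F n in sequentially. \<theta> + 2 * s * \<xi> n \<in> \<Theta>"
    and "\<And>s. s \<in> S \<Longrightarrow> convergent (\<lambda>n. max_error_prob M p n \<theta> (\<theta> + 2 * s * \<xi> n))"
    and "\<And>s. s \<in> S \<Longrightarrow> 0 < limit_error_prob M p \<xi> \<theta> s"
    and "\<And>s. s \<in> S \<Longrightarrow> \<exists>l. (loss_ratio \<rho> s \<longlongrightarrow> l) (at 0)"
  shows "local_asymptotic_minimax M \<Theta> p \<rho> (\<lambda>n. 1 / \<rho> (\<xi> n)) \<theta>
    \<ge> (SUP s\<in>S. 2 * loss_ratio_limit \<rho> s * ennreal (limit_error_prob M p \<xi> \<theta> s))"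
proof (rule SUP_least, rule local_asymptotic_minimax_ge)
  \<comment> \<open>With \<open>s\<close> and \<delta> fixed, only limits in \<open>n\<close>
    remain.\<close>
  fix s \<delta> :: real assume s: "s \<in> S" and \<delta>: "0 < \<delta>"
  define e where "e n = max_error_prob M p n \<theta> (\<theta> + 2 * s * \<xi> n)" for n
  define W where "W n = (INF g\<in>estimators M \<Theta> n.
    SUP \<theta>'\<in>{\<theta>'\<in>\<Theta>. \<bar>\<theta>' - \<theta>\<bar> \<le> \<delta>}. ennreal (1 / \<rho> (\<xi> n)) * risk M p \<rho> n g \<theta>')" for n
  define P where "P = limit_error_prob M p \<xi> \<theta> s"
  define \<omega> where "\<omega> = loss_ratio_limit \<rho> s"
  have P: "0 < P"
    unfolding P_def using assms(14)[OF s] .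
  have e_lim: "e \<longlonglongrightarrow> P"
    using assms(13)[OF s] unfolding convergent_LIMSEQ_iff P_def limit_error_prob_def e_def .
  have "(loss_ratio \<rho> s \<longlongrightarrow> \<omega>) (at 0)"
    using assms(15)[OF s] unfolding \<omega>_def loss_ratio_limit_def
    by (metis tendsto_Lim trivial_limit_at)
  \<comment> \<open>The limit of the loss ratio is over a punctured neighbourhood. Since
    \<open>\<rho> 0 = 0\<close>, positivity of \<open>\<rho> (\<xi> n)\<close> keeps
    \<open>\<xi> n\<close> away from the point 0 itself for \<open>n \<ge> 1\<close>.\<close>
  moreover have "filterlim \<xi> (at 0) sequentially"
  proof (rule filterlim_atI[OF assms(10)])
    show "\<forall>\<^sub>F n in sequentially. \<xi> n \<noteq> 0"
      using eventually_ge_at_top[of 1] by eventually_elim (use assms(8,11) in force)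
  qed
  ultimately have ratio_lim: "(\<lambda>n. loss_ratio \<rho> s (\<xi> n)) \<longlonglongrightarrow> \<omega>"
    by (rule filterlim_compose)
  \<comment> \<open>Multiplication on \<open>[0, \<infinity>]\<close> fails to be continuous only at
    0 times \<infinity>. Here \<open>\<omega>\<close> may be infinite, but \<open>P\<close> is
    positive and finite.\<close>
  have "(\<lambda>n. 2 * (loss_ratio \<rho> s (\<xi> n) * ennreal (e n))) \<longlonglongrightarrow> 2 * (\<omega> * ennreal P)"
    using P by (intro ennreal_tendsto_cmult tendsto_mult_ennreal ratio_lim tendsto_ennrealI e_lim) auto
  then have "2 * \<omega> * ennreal P = liminf (\<lambda>n. 2 * (loss_ratio \<rho> s (\<xi> n) * ennreal (e n)))"
    by (simp add: lim_imp_Liminf mult.assoc)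
  also have "\<dots> \<le> liminf W"
  proof (rule Liminf_mono)
    \<comment> \<open>The second test point \<open>\<theta> + 2 * s * \<xi> n\<close> eventually
      enters the \<delta>-neighbourhood and so competes in the local supremum.\<close>
    have "(\<lambda>n. \<bar>2 * s * \<xi> n\<bar>) \<longlonglongrightarrow> 0"
      using assms(10) by (auto intro!: tendsto_eq_intros)
    then have "\<forall>\<^sub>F n in sequentially. \<bar>2 * s * \<xi> n\<bar> < \<delta>"
      using \<delta> by (rule order_tendstoD(2))
    then show "\<forall>\<^sub>F n in sequentially. 2 * (loss_ratio \<rho> s (\<xi> n) * ennreal (e n)) \<le> W n"
      using assms(12)[OF s] eventually_ge_at_top[of 1]
    proof eventually_elim
      case (elim n)
      \<comment> \<open>The ratio splits into the normalisation and the loss at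
        \<open>s * \<xi> n\<close>, which is half the difference of the two test points, as the
        two-point bound requires.\<close>
      have "2 * (loss_ratio \<rho> s (\<xi> n) * ennreal (e n))
          = ennreal (1 / \<rho> (\<xi> n)) * (ennreal (2 * \<rho> (s * \<xi> n)) * ennreal (e n))"
      proof -
        have "loss_ratio \<rho> s (\<xi> n) = ennreal (1 / \<rho> (\<xi> n)) * ennreal (\<rho> (s * \<xi> n))"
          unfolding loss_ratio_def using assms(3) by (simp add: ennreal_mult'[symmetric])
        then show ?thesis
          using assms(3) by (simp add: ennreal_mult' mult_ac)
      qed
      also have "\<dots> = ennreal (1 / \<rho> (\<xi> n)) *
          (ennreal (2 * \<rho> ((\<theta> + 2 * s * \<xi> n - \<theta>) / 2)) * ennreal (e n))"
        by simp
      also have "\<dots> \<le> W n"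
        unfolding W_def e_def using assms(9) elim \<delta>
        by (intro local_minimax_risk_ge assms(2-5)) auto
      finally show ?case .
    qed
  qed
  finally show "2 * loss_ratio_limit \<rho> s * ennreal (limit_error_prob M p \<xi> \<theta> s)
    \<le> liminf (\<lambda>n. INF g\<in>estimators M \<Theta> n.
      SUP \<theta>'\<in>{\<theta>'\<in>\<Theta>. \<bar>\<theta>' - \<theta>\<bar> \<le> \<delta>}. ennreal (1 / \<rho> (\<xi> n)) * risk M p \<rho> n g \<theta>')"
    unfolding W_def \<omega>_def P_def .
qed

end
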